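(* Let $p,q\ge 0$ be integers and let $a_1,\dots,a_p,b_1,\dots,b_q$ be arbitrary constants. For every integer $N\ge 0$ put $$F_N(x)={}_{p+N+1}F_{q+N+1}\Bigl(a_1,\dots,a_p,\tfrac{\alpha+1}{\gamma},\tfrac{\alpha+\beta+1}{\gamma},\dots,\tfrac{\alpha+N\beta+1}{\gamma};\,b_1,\dots,b_q,\tfrac{\alpha+\gamma+1}{\gamma},\tfrac{\alpha+\gamma+\beta+1}{\gamma},\dots,\tfrac{\alpha+\gamma+N\beta+1}{\gamma};\,\lambda x^{\gamma}\Bigr).$$ Then, for any constants $\alpha,\beta,\eta,\lambda$ and any nonzero constant $\gamma$, $$e^{\eta x^\beta}\sum_{j=0}^{\infty}\frac{(-\beta\eta x^\beta)^{j}}{\prod_{m=0}^{j}(\alpha+m\beta+1)}F_{j}(x) =\cosh(\eta x^\beta)\sum_{j=0}^{\infty}\frac{(\beta\eta x^\beta)^{2j}}{\prod_{m=0}^{2j}(\alpha+m\beta+1)}F_{2j}(x)-\sinh(\eta x^\beta)\sum_{j=0}^{\infty}\frac{(\beta\eta x^\beta)^{2j+1}}{\prod_{m=0}^{2j+1}(\alpha+m\beta+1)}F_{2j+1}(x)$$ $$+\sinh(\eta x^\beta)\sum_{j=0}^{\infty}\frac{(\beta\eta x^\beta)^{2j}}{\prod_{m=0}^{2j}(\alpha+m\beta+1)}F_{2j}(x)-\cosh(\eta x^\beta)\sum_{j=0}^{\infty}\frac{(\beta\eta x^\beta)^{2j+1}}{\prod_{m=0}^{2j+1}(\alpha+m\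beta+1)}F_{2j+1}(x).$$
   Context: Constants are real or complex. The generalized hypergeometric function is defined by the series $${}_pF_q(a_1,\dots,a_p;b_1,\dots,b_q;x)=\sum_{n=0}^{\infty}\frac{(a_1)_n\cdots(a_p)_n}{(b_1)_n\cdots(b_q)_n}\frac{x^n}{n!},$$ with Pochhammer symbol $(\vartheta)_n=\Gamma(\vartheta+n)/\Gamma(\vartheta)$, $(\vartheta)_0=1$.
   Formalization: The identity is proved under the assumption that the two series on the right (over the even and the odd indices) converge; for arbitrary constants the series involved may diverge, and the claim then has no meaning. *)

theory Defs
  imports "HOL-Analysis.Analysis"
begin

text \<open>
  The library only has generalized hypergeometric series as formal power series. The lengths
  of the lists \<open>as\<close> and \<open>bs\<close> are the indices \<open>p\<close> and \<open>q\<close>; both may be empty.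
\<close>

definition hypergeo :: "complex list \<Rightarrow> complex list \<Rightarrow> complex \<Rightarrow> complex" where
  "hypergeo as bs z = eval_fps (fps_hypergeo as bs 1) z"

lemma hypergeo_altdef:
  "hypergeo as bs z =
     (\<Sum>n. (\<Prod>a\<leftarrow>as. pochhammer a n) / (\<Prod>b\<leftarrow>bs. pochhammer b n) * (z ^ n / fact n))"
proof -
  have foldl_eq: "foldl (\<lambda>r a. r * pochhammer a n) c cs = c * (\<Prod>a\<leftarrow>cs. pochhammer a n)"
    for c :: complex and cs n
    by (induction cs arbitrary: c) (simp_all add: mult.assoc)
  show ?thesis
    by (simp add: hypergeo_def eval_fps_def fps_hypergeo_def foldl_eq)
qed

text \<open>
  Complex powers are principal values, so \<open>z powr \<gamma> = exp (\<gamma> * Ln z)\<close> for \<open>z \<noteq> 0\<close>.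
\<close>

definition F :: "complex list \<Rightarrow> complex list \<Rightarrow> complex \<Rightarrow> complex \<Rightarrow> complex \<Rightarrow> complex
    \<Rightarrow> nat \<Rightarrow> complex \<Rightarrow> complex" where
  "F as bs \<alpha> \<beta> \<gamma> \<Lambda> N x =
     hypergeo
       (as @ map (\<lambda>m. (\<alpha> + of_nat m * \<beta> + 1) / \<gamma>) [0..<Suc N])
       (bs @ map (\<lambda>m. (\<alpha> + \<gamma> + of_nat m * \<beta> + 1) / \<gamma>) [0..<Suc N])
       (\<Lambda> * x powr \<gamma>)"

end

theory Submission
  imports Defs
begin

text \<open>
  Write \<open>t = \<eta> x powr \<beta>\<close> and let \<open>c j\<close> be the coefficient \<open>F\<^sub>j(x) / (\<Prod>m\<le>j. \<alpha> + m \<beta> + 1)\<close>. The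
  left-hand series \<open>\<Sum>j. (- \<beta> t) ^ j * c j\<close> differs from \<open>\<Sum>j. (\<beta> t) ^ j * c j\<close> only in the sign
  of its odd terms, so splitting by parity gives it the value \<open>E - D\<close>, where \<open>E\<close> and \<open>D\<close> are the
  even and the odd part of the second series. With \<open>exp t = cosh t + sinh t\<close>, expanding
  \<open>(cosh t + sinh t) * (E - D)\<close> yields the four products of the identity.

  The one analytic point is convergence: the parity split of the left-hand series takes for
  granted that it converges. It does, because a convergent series stays convergent when zeros are
  interspersed, and the left-hand series is the difference of two series of this kind.
\<close>

text \<open>
  Padding with zeros turns both given series into series over all indices with unchanged sums;
  their termwise difference is the alternating series.
\<close>

lemma alternating_power_series_sums:
  fixes w :: "'a::real_normed_field" and c :: "nat \<Rightarrow> 'a"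
  assumes even: "(\<lambda>j. w ^ (2 * j) * c (2 * j)) sums E"
    and odd: "(\<lambda>j. w ^ (2 * j + 1) * c (2 * j + 1)) sums D"
  shows "(\<lambda>j. (- w) ^ j * c j) sums (E - D)"
proof -
  let ?f = "\<lambda>n. w ^ n * c n"
  have "(\<lambda>n. if even n then ?f n else 0) sums E"
  proof (rule sums_mono_reindex[where g = "\<lambda>j. 2 * j", THEN iffD1])
    show "strict_mono (\<lambda>j::nat. 2 * j)"
      by (simp add: strict_mono_def)
  qed (use even in auto)
  moreover have "(\<lambda>n. if odd n then ?f n else 0) sums D"
  proof (rule sums_mono_reindex[where g = "\<lambda>j. 2 * j + 1", THEN iffD1])
    show "strict_mono (\<lambda>j::nat. 2 * j + 1)"
      by (simp add: strict_mono_def)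
  qed (use odd in \<open>auto elim!: oddE\<close>)
  ultimately have "(\<lambda>n. (if even n then ?f n else 0) - (if odd n then ?f n else 0)) sums (E - D)"
    by (rule sums_diff)
  moreover have "(if even n then ?f n else 0) - (if odd n then ?f n else 0) = (- w) ^ n * c n" for n
    by simp
  ultimately show ?thesis
    by simp
qed

theorem theorem3:
  fixes as bs :: "complex list" and \<alpha> \<beta> \<gamma> \<eta> \<Lambda> x :: complex
  assumes "\<gamma> \<noteq> 0"
    and "summable (\<lambda>j. (\<beta> * \<eta> * x powr \<beta>) ^ (2 * j) / (\<Prod>m\<le>2 * j. \<alpha> + of_nat m * \<beta> + 1)
           * F as bs \<alpha> \<beta> \<gamma> \<Lambda> (2 * j) x)"
    and "summable (\<lambda>j. (\<beta> * \<eta> * x powr \<beta>) ^ (2 * j + 1) / (\<Prod>m\<le>2 * j + 1. \<alpha> + of_nat m * \<beta> + 1)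
           * F as bs \<alpha> \<beta> \<gamma> \<Lambda> (2 * j + 1) x)"
  shows "exp (\<eta> * x powr \<beta>) *
           (\<Sum>j. (- \<beta> * \<eta> * x powr \<beta>) ^ j / (\<Prod>m\<le>j. \<alpha> + of_nat m * \<beta> + 1)
              * F as bs \<alpha> \<beta> \<gamma> \<Lambda> j x)
         = cosh (\<eta> * x powr \<beta>) *
             (\<Sum>j. (\<beta> * \<eta> * x powr \<beta>) ^ (2 * j) / (\<Prod>m\<le>2 * j. \<alpha> + of_nat m * \<beta> + 1)
                * F as bs \<alpha> \<beta> \<gamma> \<Lambda> (2 * j) x)
         - sinh (\<eta> * x powr \<beta>) *
             (\<Sum>j. (\<beta> * \<eta> * x powr \<beta>) ^ (2 * j + 1) / (\<Prod>m\<le>2 * j + 1. \<alpha> + of_nat m * \<beta> + 1)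
                * F as bs \<alpha> \<beta> \<gamma> \<Lambda> (2 * j + 1) x)
         + sinh (\<eta> * x powr \<beta>) *
             (\<Sum>j. (\<beta> * \<eta> * x powr \<beta>) ^ (2 * j) / (\<Prod>m\<le>2 * j. \<alpha> + of_nat m * \<beta> + 1)
                * F as bs \<alpha> \<beta> \<gamma> \<Lambda> (2 * j) x)
         - cosh (\<eta> * x powr \<beta>) *
             (\<Sum>j. (\<beta> * \<eta> * x powr \<beta>) ^ (2 * j + 1) / (\<Prod>m\<le>2 * j + 1. \<alpha> + of_nat m * \<beta> + 1)
                * F as bs \<alpha> \<beta> \<gamma> \<Lambda> (2 * j + 1) x)"
proof -
  define t where "t = \<eta> * x powr \<beta>"
  define w where "w = \<beta> * \<eta> * x powr \<beta>"
  define c where "c j = F as bs \<alpha> \<beta> \<gamma> \<Lambda> j x / (\<Prod>m\<le>j. \<alpha> + of_nat m * \<beta> + 1)" for j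
  define E where "E = (\<Sum>j. w ^ (2 * j) * c (2 * j))"
  define D where "D = (\<Sum>j. w ^ (2 * j + 1) * c (2 * j + 1))"
  have regroup: "v ^ j / (\<Prod>m\<le>j. \<alpha> + of_nat m * \<beta> + 1) * F as bs \<alpha> \<beta> \<gamma> \<Lambda> j x = v ^ j * c j"
    for v j
    by (simp add: c_def)
  have neg: "- \<beta> * \<eta> * x powr \<beta> = - w"
    by (simp add: w_def)
  have "(\<lambda>j. w ^ (2 * j) * c (2 * j)) sums E"
    using assms(2) unfolding regroup w_def[symmetric] E_def by (rule summable_sums)
  moreover have "(\<lambda>j. w ^ (2 * j + 1) * c (2 * j + 1)) sums D"
    using assms(3) unfolding regroup w_def[symmetric] D_def by (rule summable_sums)
  ultimately have "(\<Sum>j. (- w) ^ j * c j) = E - D"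
    by (intro sums_unique[symmetric] alternating_power_series_sums)
  then have "exp t * (\<Sum>j. (- w) ^ j * c j) = (cosh t + sinh t) * (E - D)"
    by (simp only: cosh_plus_sinh)
  also have "\<dots> = cosh t * E - sinh t * D + sinh t * E - cosh t * D"
    by (simp add: algebra_simps)
  finally show ?thesis
    unfolding regroup neg w_def[symmetric] t_def[symmetric] E_def[symmetric] D_def[symmetric] .
qed

end
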